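(* Let $n$ be a positive integer and let $\mathcal{Q}=\{[1,i]: i\in[n]\}$. Then $$\frac{n}{\sqrt{8}}\le \mathrm{val}_{\mathcal{Q}}\le n.$$
   Context: $[n]=\{1,\dots,n\}$, $[1,i]=\{1,\dots,i\}$, $\bar S=[n]\setminus S$. A function $f:\{-1,1\}^n\to\mathbb{R}$ is odd if $f(-x)=-f(x)$ for all $x$; $\|f\|_\infty=\max_x|f(x)|$. For $S\subseteq[n]$ and $b\in\{-1,1\}^{\bar S}$, $f_{S|b}:\{-1,1\}^S\to\mathbb{R}$ is the restriction of $f$ obtained by fixing the coordinates in $\bar S$ to $b$. $\mathrm{Var}(g)$ is the variance of $g(\mathbf{x})$ for $\mathbf{x}$ uniform on the domain of $g$. For $\mathcal{Q}\subseteq 2^{[n]}$, $$\mathrm{val}_{\mathcal{Q}} := \max_{\substack{f : \{-1,1\}^n \to \mathbb{R}\\ f \text{ odd},\ f\not\equiv 0}} \frac{\|f\|_\infty}{\max\limits_{S \in \mathcal{Q},\ b \in \{-1,1\}^{\bar{S}}}\sqrt{\mathrm{Var}(f_{S|b})}}.$$ *)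

theory Defs
  imports "HOL-Probability.Probability"
begin

text \<open>The cube \<open>{-1,1}\<^sup>S\<close> for an index set \<open>S\<close>: extensional functions on \<open>S\<close>, so
  every point has exactly one representative.\<close>

definition cube :: "nat set \<Rightarrow> (nat \<Rightarrow> real) set" where
  "cube S = S \<rightarrow>\<^sub>E {-1, 1}"

text \<open>A function on \<open>{-1,1}\<^sup>n\<close> is a function on the whole type of which only the values on
  \<^term>\<open>cube {1..n}\<close> are ever used; accordingly \<open>-x\<close> is negated coordinatewise on
  \<^term>\<open>{1..n}\<close> only, which keeps it extensional.\<close>

definition odd_fun :: "nat \<Rightarrow> ((nat \<Rightarrow> real) \<Rightarrow> real) \<Rightarrow> bool" where
  "odd_fun n f \<longleftrightarrow> (\<forall>x\<in>cube {1..n}. f (restrict (\<lambda>i. - x i) {1..n}) = - f x)"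

definition sup_norm :: "nat \<Rightarrow> ((nat \<Rightarrow> real) \<Rightarrow> real) \<Rightarrow> real" where
  "sup_norm n f = Max ((\<lambda>x. \<bar>f x\<bar>) ` cube {1..n})"

definition subfun :: "nat \<Rightarrow> ((nat \<Rightarrow> real) \<Rightarrow> real) \<Rightarrow> nat set \<Rightarrow> (nat \<Rightarrow> real) \<Rightarrow> (nat \<Rightarrow> real) \<Rightarrow> real" where
  "subfun n f S b = (\<lambda>y. f (merge S ({1..n} - S) (y, b)))"

definition cube_var :: "nat set \<Rightarrow> ((nat \<Rightarrow> real) \<Rightarrow> real) \<Rightarrow> real" where
  "cube_var S g = measure_pmf.variance (pmf_of_set (cube S)) g"

definition max_std :: "nat \<Rightarrow> nat set set \<Rightarrow> ((nat \<Rightarrow> real) \<Rightarrow> real) \<Rightarrow> real" where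
  "max_std n Q f =
     Max {sqrt (cube_var S (subfun n f S b)) |S b. S \<in> Q \<and> b \<in> cube ({1..n} - S)}"

text \<open>\<open>val\<close> is a genuine maximum: \<^const>\<open>Greatest\<close> is unspecified unless it is attained.
  The definition is meant for nonempty \<open>Q \<subseteq> Pow {1..n}\<close> such that \<^term>\<open>max_std n Q f\<close>
  is nonzero for every odd \<open>f\<close> that is not identically zero. This is the case when
  \<open>{1..n} \<in> Q\<close>, since an odd function has mean zero; so division by zero plays no role.\<close>

definition val :: "nat \<Rightarrow> nat set set \<Rightarrow> real" where
  "val n Q = (GREATEST r. \<exists>f. odd_fun n f \<and> (\<exists>x\<in>cube {1..n}. f x \<noteq> 0) \<and>
                              r = sup_norm n f / max_std n Q f)"

end

theory Submission
  imports Defs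
begin

text \<open>
  Reveal the coordinates of \<open>x\<close> in the order \<open>x\<^sub>n, \<dots>, x\<^sub>1\<close>. The conditional means of \<open>f\<close> form a
  martingale that starts at \<open>0\<close> because \<open>f\<close> is odd and ends at \<open>f x\<close>; its \<open>n\<close> steps are each bounded
  by the standard deviation of a restriction \<open>f\<^bsub>[1,i]|b\<^esub>\<close>, which gives the upper bound.

  For the lower bound take the martingale that moves by \<open>x\<^sub>j\<close> as long as all coordinates revealed
  before \<open>x\<^sub>j\<close> agree, and then stops: \<open>f x = (\<Sum>j. x\<^sub>j \<cdot> 1[x\<^sub>j\<^sub>+\<^sub>1 = \<dots> = x\<^sub>n])\<close>. It reaches \<open>n\<close> at the
  all-ones point, while the stopping probability \<open>1/2\<close> at each step keeps all variances at most \<open>3\<close>.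

  That the maximum in \<open>val\<close> is attained follows by compactness after normalising the largest standard
  deviation to be at most \<open>1\<close>.
\<close>

section \<open>Means and variances on the cube\<close>

lemma finite_cube [simp]: "finite S \<Longrightarrow> finite (cube S)"
  unfolding cube_def by (intro finite_PiE) auto

lemma cube_nonempty [simp]: "cube S \<noteq> {}"
  unfolding cube_def by (simp add: PiE_eq_empty_iff)

lemma card_cube: "finite S \<Longrightarrow> card (cube S) = 2 ^ card S"
  unfolding cube_def by (simp add: card_funcsetE numeral_2_eq_2)

lemma cube_empty [simp]: "cube {} = {\<lambda>_. undefined}"
  by (simp add: cube_def)

lemma restrict_in_cube: "x \<in> cube T \<Longrightarrow> S \<subseteq> T \<Longrightarrow> restrict x S \<in> cube S"
  by (auto simp: cube_def PiE_iff)

lemma cube_outside: "x \<in> cube S \<Longrightarrow> i \<notin> S \<Longrightarrow> x i = undefined"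
  by (auto simp: cube_def PiE_iff extensional_def)

text \<open>The uniform expectation as a bare finite sum, convenient for splitting off coordinates
  and for continuity in the function; \<open>expectation_cube\<close> ties it to the probabilistic
  variance.\<close>

definition cube_mean :: "nat set \<Rightarrow> ((nat \<Rightarrow> real) \<Rightarrow> real) \<Rightarrow> real" where
  "cube_mean S g = (\<Sum>x\<in>cube S. g x) / 2 ^ card S"

lemma cube_mean_empty [simp]: "cube_mean {} g = g (\<lambda>_. undefined)"
  by (simp add: cube_mean_def)

lemma cube_mean_cong: "(\<And>x. x \<in> cube S \<Longrightarrow> f x = g x) \<Longrightarrow> cube_mean S f = cube_mean S g"
  by (simp add: cube_mean_def)

lemma cube_mean_nonneg: "(\<And>x. x \<in> cube S \<Longrightarrow> 0 \<le> g x) \<Longrightarrow> 0 \<le> cube_mean S g"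
  by (simp add: cube_mean_def sum_nonneg)

lemma expectation_cube:
  "finite S \<Longrightarrow> measure_pmf.expectation (pmf_of_set (cube S)) g = cube_mean S g"
  by (simp add: integral_pmf_of_set cube_mean_def card_cube)

lemma cube_var_eq:
  assumes "finite S"
  shows "cube_var S g = cube_mean S (\<lambda>x. (g x - cube_mean S g)\<^sup>2)"
  using assms by (simp add: cube_var_def expectation_cube)

lemma cube_var_eq_diff:
  assumes "finite S"
  shows "cube_var S g = cube_mean S (\<lambda>x. (g x)\<^sup>2) - (cube_mean S g)\<^sup>2"
proof -
  define m where "m = cube_mean S g"
  have sum_g: "(\<Sum>x\<in>cube S. g x) = m * 2 ^ card S"
    by (simp add: m_def cube_mean_def)
  have "(\<Sum>x\<in>cube S. (g x - m)\<^sup>2)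
      = (\<Sum>x\<in>cube S. (g x)\<^sup>2) - 2 * m * (\<Sum>x\<in>cube S. g x) + 2 ^ card S * m\<^sup>2"
    using assms
    by (simp add: power2_diff sum.distrib sum_subtractf card_cube sum_distrib_left algebra_simps)
  also have "\<dots> = (\<Sum>x\<in>cube S. (g x)\<^sup>2) - m\<^sup>2 * 2 ^ card S"
    unfolding sum_g by (simp add: power2_eq_square algebra_simps)
  finally have "(\<Sum>x\<in>cube S. (g x - m)\<^sup>2) = (\<Sum>x\<in>cube S. (g x)\<^sup>2) - m\<^sup>2 * 2 ^ card S" .
  then show ?thesis
    unfolding cube_var_eq[OF assms] m_def[symmetric]
    by (simp add: cube_mean_def diff_divide_distrib)
qed

lemma cube_var_cong:
  assumes "finite S" "\<And>x. x \<in> cube S \<Longrightarrow> f x = g x"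
  shows "cube_var S f = cube_var S g"
  using assms cube_mean_cong[of S f g] by (simp add: cube_var_eq cong: cube_mean_cong)

lemma cube_var_nonneg: "finite S \<Longrightarrow> 0 \<le> cube_var S g"
  by (simp add: cube_var_eq cube_mean_nonneg)

lemma cube_var_empty [simp]: "cube_var {} g = 0"
  by (simp add: cube_var_eq)

lemma cube_var_divide:
  assumes "finite S"
  shows "cube_var S (\<lambda>x. g x / c) = cube_var S g / c\<^sup>2"
  using assms
  by (simp add: cube_var_eq_diff cube_mean_def power_divide power_mult_distrib
      diff_divide_distrib mult.commute flip: sum_divide_distrib)

section \<open>Splitting off one coordinate\<close>

lemma sum_cube_insert:
  assumes "finite S" "k \<notin> S"
  shows "(\<Sum>x\<in>cube (insert k S). g x)
       = (\<Sum>y\<in>cube S. g (y(k := 1))) + (\<Sum>y\<in>cube S. g (y(k := -1)))"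
proof -
  have "(\<Sum>x\<in>cube (insert k S). g x)
      = (\<Sum>(s, y)\<in>{-1, 1} \<times> cube S. g (y(k := s)))"
    unfolding cube_def PiE_insert_eq
    using inj_combinator[OF assms(2), of "\<lambda>_. {-1, 1::real}"]
    by (subst sum.reindex) (auto intro!: sum.cong)
  also have "\<dots> = (\<Sum>s\<in>{-1, 1}. \<Sum>y\<in>cube S. g (y(k := s)))"
    using assms by (subst sum.cartesian_product) auto
  finally show ?thesis by (simp add: add.commute)
qed

lemma cube_mean_insert:
  assumes "finite S" "k \<notin> S"
  shows "cube_mean (insert k S) g
       = (cube_mean S (\<lambda>y. g (y(k := 1))) + cube_mean S (\<lambda>y. g (y(k := -1)))) / 2"
  using assms by (simp add: cube_mean_def sum_cube_insert add_divide_distrib)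

text \<open>Law of total variance, conditioning on coordinate \<open>k\<close>: the mean of the two
  conditional variances plus the variance of the conditional mean, a fair choice between two
  values.\<close>

lemma cube_var_insert:
  assumes "finite S" "k \<notin> S"
  shows "cube_var (insert k S) g
       = (cube_var S (\<lambda>y. g (y(k := 1))) + cube_var S (\<lambda>y. g (y(k := -1)))) / 2
         + ((cube_mean S (\<lambda>y. g (y(k := 1))) - cube_mean S (\<lambda>y. g (y(k := -1)))) / 2)\<^sup>2"
proof -
  have identity: "(a + b) / 2 - ((p + q) / 2)\<^sup>2
      = ((a - p\<^sup>2) + (b - q\<^sup>2)) / 2 + ((p - q) / 2)\<^sup>2" for a b p q :: real
    by (simp add: power2_eq_square field_simps)
  show ?thesis
    using assms by (simp add: cube_var_eq_diff cube_mean_insert identity)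
qed

section \<open>Restrictions\<close>

text \<open>Both sides merge to the same point: a free coordinate, once set, can be moved into the
  fixed assignment. This drives every recursion over coordinates below.\<close>

lemma subfun_insert:
  assumes "k \<in> {1..n}" "k \<notin> S"
  shows "subfun n f (insert k S) b (y(k := s)) = subfun n f S (b(k := s)) y"
proof -
  have "merge (insert k S) ({1..n} - insert k S) (y(k := s), b)
      = merge S ({1..n} - S) (y, b(k := s))"
    using assms by (auto simp: merge_def fun_eq_iff)
  then show ?thesis by (simp add: subfun_def)
qed

lemma subfun_empty:
  assumes "\<And>i. i \<notin> {1..n} \<Longrightarrow> x i = undefined"
  shows "subfun n f {} x y = f x"
proof -
  have "merge {} {1..n} (y, x) = x"
    using assms by (auto simp: merge_def fun_eq_iff)
  then show ?thesis by (simp add: subfun_def)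
qed

lemma subfun_full:
  assumes "y \<in> cube {1..n}"
  shows "subfun n f {1..n} b y = f y"
proof -
  have "merge {1..n} {} (y, b) = y"
    using assms by (auto simp: merge_def fun_eq_iff cube_outside)
  then show ?thesis by (simp add: subfun_def)
qed

lemma merge_in_cube:
  assumes "S \<subseteq> {1..n}" "y \<in> cube S" "b \<in> cube ({1..n} - S)"
  shows "merge S ({1..n} - S) (y, b) \<in> cube {1..n}"
  using assms by (auto simp: cube_def PiE_iff merge_def extensional_def)

text \<open>Conditional expectation of \<open>f\<close> given that the coordinates outside
  \<open>S\<close> agree with \<open>b\<close>. The merge reads \<open>b\<close> only on
  \<open>{1..n} - S\<close>, so \<open>b\<close> may be any function.\<close>

definition cond_mean :: "nat \<Rightarrow> ((nat \<Rightarrow> real) \<Rightarrow> real) \<Rightarrow> nat set \<Rightarrow> (nat \<Rightarrow> real) \<Rightarrow> real" where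
  "cond_mean n f S b = cube_mean S (subfun n f S b)"

definition cond_var :: "nat \<Rightarrow> ((nat \<Rightarrow> real) \<Rightarrow> real) \<Rightarrow> nat set \<Rightarrow> (nat \<Rightarrow> real) \<Rightarrow> real" where
  "cond_var n f S b = cube_var S (subfun n f S b)"

lemma cond_mean_insert:
  assumes "finite S" "k \<in> {1..n}" "k \<notin> S"
  shows "cond_mean n f (insert k S) b
       = (cond_mean n f S (b(k := 1)) + cond_mean n f S (b(k := -1))) / 2"
  using assms by (simp add: cond_mean_def cube_mean_insert subfun_insert)

lemma cond_var_insert:
  assumes "finite S" "k \<in> {1..n}" "k \<notin> S"
  shows "cond_var n f (insert k S) b
       = (cond_var n f S (b(k := 1)) + cond_var n f S (b(k := -1))) / 2
         + ((cond_mean n f S (b(k := 1)) - cond_mean n f S (b(k := -1))) / 2)\<^sup>2"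
  using assms by (simp add: cond_mean_def cond_var_def cube_var_insert subfun_insert)

text \<open>The two branch means are equally far from their average, and the square of this distance
  is exactly the between-branch term of the total variance.\<close>

lemma cond_mean_step:
  assumes "finite S" "k \<in> {1..n}" "k \<notin> S" "s \<in> {-1, 1}"
  shows "\<bar>cond_mean n f S (b(k := s)) - cond_mean n f (insert k S) b\<bar>
       \<le> sqrt (cond_var n f (insert k S) b)"
proof (rule real_le_rsqrt)
  have "(cond_mean n f S (b(k := s)) - cond_mean n f (insert k S) b)\<^sup>2
      = ((cond_mean n f S (b(k := 1)) - cond_mean n f S (b(k := -1))) / 2)\<^sup>2"
    using assms by (auto simp: cond_mean_insert power2_eq_square field_simps)
  also have "\<dots> \<le> cond_var n f (insert k S) b"
    unfolding cond_var_insert[OF assms(1-3)] using assms(1)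
    by (simp add: cond_var_def cube_var_nonneg)
  finally show "\<bar>cond_mean n f S (b(k := s)) - cond_mean n f (insert k S) b\<bar>\<^sup>2
      \<le> cond_var n f (insert k S) b"
    by simp
qed

section \<open>The finite maxima \<open>max_std\<close> and \<open>sup_norm\<close>\<close>

lemma max_std_eq:
  "max_std n Q f = Max ((\<lambda>(S, b). sqrt (cond_var n f S b)) ` (SIGMA S:Q. cube ({1..n} - S)))"
  unfolding max_std_def cond_var_def by (rule arg_cong[where f = Max]) auto

lemma finite_restrictions:
  assumes "Q \<subseteq> Pow {1..n}"
  shows "finite (SIGMA S:Q. cube ({1..n} - S))"
  using assms by (intro finite_SigmaI) (auto intro: finite_subset)

lemma std_le_max_std:
  assumes "Q \<subseteq> Pow {1..n}" "S \<in> Q" "b \<in> cube ({1..n} - S)"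
  shows "sqrt (cond_var n f S b) \<le> max_std n Q f"
  unfolding max_std_eq using assms finite_restrictions[OF assms(1)]
  by (intro Max_ge) (auto intro!: image_eqI[where x = "(S, b)"])

lemma max_std_le_iff:
  assumes "Q \<subseteq> Pow {1..n}" "Q \<noteq> {}"
  shows "max_std n Q f \<le> c
     \<longleftrightarrow> (\<forall>S\<in>Q. \<forall>b\<in>cube ({1..n} - S). sqrt (cond_var n f S b) \<le> c)"
  unfolding max_std_eq using assms finite_restrictions[OF assms(1)]
  by (subst Max_le_iff) (auto simp: Sigma_empty_iff)

lemma abs_le_sup_norm: "x \<in> cube {1..n} \<Longrightarrow> \<bar>f x\<bar> \<le> sup_norm n f"
  unfolding sup_norm_def by (intro Max_ge) auto

lemma sup_norm_le_iff: "sup_norm n f \<le> c \<longleftrightarrow> (\<forall>x\<in>cube {1..n}. \<bar>f x\<bar> \<le> c)"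
  unfolding sup_norm_def by (subst Max_le_iff) auto

lemma sup_norm_pos_iff: "0 < sup_norm n f \<longleftrightarrow> (\<exists>x\<in>cube {1..n}. f x \<noteq> 0)"
  unfolding sup_norm_def by (subst Max_gr_iff) auto

section \<open>The upper bound\<close>

lemma negate_in_cube: "x \<in> cube S \<Longrightarrow> restrict (\<lambda>i. - x i) S \<in> cube S"
  by (auto simp: cube_def PiE_iff)

lemma negate_negate:
  assumes "x \<in> cube S"
  shows "restrict (\<lambda>i. - restrict (\<lambda>i. - x i) S i) S = x"
  using assms by (auto simp: fun_eq_iff cube_outside)

text \<open>Negation is an involution of the cube, so the sum equals its own negative.\<close>

lemma odd_fun_mean_zero:
  assumes "odd_fun n f"
  shows "cube_mean {1..n} f = 0"
proof -
  have "(\<Sum>x\<in>cube {1..n}. f x) = (\<Sum>x\<in>cube {1..n}. f (restrict (\<lambda>i. - x i) {1..n}))"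
    by (rule sum.reindex_bij_witness[where i = "\<lambda>x. restrict (\<lambda>i. - x i) {1..n}"
          and j = "\<lambda>x. restrict (\<lambda>i. - x i) {1..n}"])
      (simp_all only: negate_negate negate_in_cube)
  also have "\<dots> = - (\<Sum>x\<in>cube {1..n}. f x)"
    using assms by (simp add: odd_fun_def sum_negf)
  finally show ?thesis by (simp add: cube_mean_def)
qed

text \<open>Downward induction from \<open>i = n\<close>, where the mean is \<open>0\<close>.
  Revealing \<open>x (Suc i)\<close> moves the mean by at most the standard deviation over
  \<open>{1..Suc i}\<close>, a member of \<open>Q\<close>; no variance over the empty prefix is ever
  used.\<close>

lemma cond_mean_prefix_bound:
  assumes odd: "odd_fun n f" and Q: "Q = {{1..i} |i. i \<in> {1..n}}"
    and x: "x \<in> cube {1..n}" and "i \<le> n"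
  shows "\<bar>cond_mean n f {1..i} (restrict x ({1..n} - {1..i}))\<bar> \<le> real (n - i) * max_std n Q f"
  using \<open>i \<le> n\<close>
proof (induction rule: inc_induct)
  case base
  have "cube_mean {1..n} (subfun n f {1..n} b) = cube_mean {1..n} f" for b
    by (intro cube_mean_cong subfun_full)
  with odd_fun_mean_zero[OF odd] show ?case
    by (simp add: cond_mean_def)
next
  case (step i)
  define b where "b = restrict x ({1..n} - {1..Suc i})"
  have ins: "{1..Suc i} = insert (Suc i) {1..i}" by auto
  have b_upd: "restrict x ({1..n} - {1..i}) = b(Suc i := x (Suc i))"
    using step.hyps by (auto simp: b_def restrict_def fun_eq_iff)
  have "x (Suc i) \<in> {-1, 1}"
    using x step.hyps unfolding cube_def by (intro PiE_mem[OF x[unfolded cube_def]]) auto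
  then have "\<bar>cond_mean n f {1..i} (b(Suc i := x (Suc i))) - cond_mean n f {1..Suc i} b\<bar>
      \<le> sqrt (cond_var n f {1..Suc i} b)"
    unfolding ins using step.hyps by (intro cond_mean_step) auto
  also have "\<dots> \<le> max_std n Q f"
    using step.hyps x unfolding b_def Q
    by (intro std_le_max_std restrict_in_cube[OF x]) auto
  finally have "\<bar>cond_mean n f {1..i} (b(Suc i := x (Suc i)))\<bar>
      \<le> max_std n Q f + real (n - Suc i) * max_std n Q f"
    using step.IH unfolding b_def[symmetric] by linarith
  also have "\<dots> = real (n - i) * max_std n Q f"
  proof -
    have "n - i = Suc (n - Suc i)" using step.hyps by simp
    then show ?thesis by (simp add: algebra_simps)
  qed
  finally show ?case unfolding b_upd .
qed

lemma sup_norm_le_max_std: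
  assumes "odd_fun n f" "Q = {{1..i} |i. i \<in> {1..n}}"
  shows "sup_norm n f \<le> real n * max_std n Q f"
  unfolding sup_norm_le_iff
proof
  fix x assume x: "x \<in> cube {1..n}"
  then have "restrict x {1..n} = x"
    by (auto simp: fun_eq_iff cube_outside)
  \<comment> \<open>At \<open>i = 0\<close> no coordinate is free, so the conditional mean is the
    value \<open>f x\<close>.\<close>
  with x have "cond_mean n f {1..0} (restrict x ({1..n} - {1..0})) = f x"
    using subfun_empty[of n x f] cube_outside[OF x] by (simp add: cond_mean_def)
  with cond_mean_prefix_bound[OF assms x, of 0] show "\<bar>f x\<bar> \<le> real n * max_std n Q f"
    by simp
qed

section \<open>The maximum is attained\<close>

lemma continuous_on_Max_image:
  fixes g :: "'a \<Rightarrow> 'b::topological_space \<Rightarrow> real"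
  assumes "finite A" "A \<noteq> {}" "\<And>a. a \<in> A \<Longrightarrow> continuous_on X (g a)"
  shows "continuous_on X (\<lambda>x. Max ((\<lambda>a. g a x) ` A))"
  using assms
proof (induction rule: finite_ne_induct)
  case (singleton a)
  then show ?case by simp
next
  case (insert a A)
  then have "continuous_on X (\<lambda>x. max (g a x) (Max ((\<lambda>a. g a x) ` A)))"
    by (intro continuous_on_max) auto
  with insert.hyps show ?case by simp
qed

text \<open>In the product topology evaluation at a point is continuous, and only finitely many
  evaluations enter.\<close>

lemma continuous_on_sup_norm: "continuous_on X (sup_norm n)"
  unfolding sup_norm_def[abs_def]
  by (intro continuous_on_Max_image continuous_intros
      continuous_on_subset[OF continuous_on_product_coordinates]) auto

lemma continuous_on_cond_var: "finite S \<Longrightarrow> continuous_on X (\<lambda>f. cond_var n f S b)"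
  unfolding cond_var_def subfun_def
  by (simp add: cube_var_eq cube_mean_def)
    (intro continuous_intros continuous_on_subset[OF continuous_on_product_coordinates]; simp)

lemma continuous_on_max_std:
  assumes "Q \<subseteq> Pow {1..n}" "Q \<noteq> {}"
  shows "continuous_on X (max_std n Q)"
  unfolding max_std_eq[abs_def]
proof (intro continuous_on_Max_image finite_restrictions assms(1))
  show "(SIGMA S:Q. cube ({1..n} - S)) \<noteq> {}"
    using assms(2) cube_nonempty by (simp add: Sigma_empty_iff)
next
  fix p assume "p \<in> (SIGMA S:Q. cube ({1..n} - S))"
  then obtain S b where p: "p = (S, b)" "S \<in> Q" by auto
  with assms(1) have "finite S" by (meson Pow_iff finite_atLeastAtMost finite_subset in_mono)
  then show "continuous_on X (\<lambda>f. case p of (S, b) \<Rightarrow> sqrt (cond_var n f S b))"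
    by (simp add: p continuous_on_real_sqrt continuous_on_cond_var)
qed

lemma closed_odd_fun: "closed (Collect (odd_fun n))"
proof -
  have "closed {f :: (nat \<Rightarrow> real) \<Rightarrow> real. f y = - f x}" for x y
    by (intro closed_Collect_eq continuous_intros continuous_on_product_coordinates)
  moreover have "Collect (odd_fun n)
      = (\<Inter>x\<in>cube {1..n}. {f. f (restrict (\<lambda>i. - x i) {1..n}) = - f x})"
    by (auto simp: odd_fun_def)
  ultimately show ?thesis by (simp add: closed_INT)
qed

text \<open>\<open>GREATEST\<close> yields information only once a maximiser is exhibited. The bound
  with constant \<open>c\<close> serves twice: it forces positive denominators, and it confines the
  normalised functions to a compact box.\<close>

lemma val_attained:
  assumes Q: "Q \<subseteq> Pow {1..n}" "Q \<noteq> {}"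
    and bound: "\<And>f. odd_fun n f \<Longrightarrow> sup_norm n f \<le> c * max_std n Q f" and "0 \<le> c"
    and g: "odd_fun n g" "\<exists>x\<in>cube {1..n}. g x \<noteq> 0"
  shows "sup_norm n g / max_std n Q g \<le> val n Q" "val n Q \<le> c"
proof -
  have D_pos: "0 < max_std n Q f" if "odd_fun n f" "\<exists>x\<in>cube {1..n}. f x \<noteq> 0" for f
    using that(2) bound[OF that(1)] \<open>0 \<le> c\<close> unfolding sup_norm_pos_iff[symmetric]
    by (metis less_le_trans not_less_iff_gr_or_eq zero_less_mult_pos linorder_not_le
        mult_nonneg_nonpos)
  \<comment> \<open>Values off the cube are pinned to \<open>0\<close>, so every factor is compact
    and Tychonoff applies to functions on the whole type.\<close>
  define K where "K = (\<Pi>\<^sub>E x\<in>UNIV. if x \<in> cube {1..n} then {-c..c} else {0::real})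
      \<inter> (Collect (odd_fun n) \<inter> {f. max_std n Q f \<le> 1})"
  have "compact (\<Pi>\<^sub>E x\<in>UNIV. if x \<in> cube {1..n} then {-c..c} else {0::real})"
    using compactin_PiE[of "\<lambda>_. euclidean" UNIV
        "\<lambda>x. if x \<in> cube {1..n} then {-c..c} else {0::real}"]
    by (simp add: euclidean_product_topology)
  then have "compact K"
    unfolding K_def
    by (intro compact_Int_closed closed_Int closed_odd_fun closed_Collect_le
        continuous_on_max_std Q continuous_on_const)
  define normalised where
    "normalised = (\<lambda>f x. if x \<in> cube {1..n} then f x / max_std n Q f else 0)"
  have norm_K: "normalised f \<in> K" and sup_norm_normalised:
    "sup_norm n (normalised f) = sup_norm n f / max_std n Q f"
    if f: "odd_fun n f" "\<exists>x\<in>cube {1..n}. f x \<noteq> 0" for f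
  proof -
    define D where "D = max_std n Q f"
    have "0 < D" using D_pos[OF f] by (simp add: D_def)
    have odd: "odd_fun n (normalised f)"
      using f(1) by (auto simp: odd_fun_def normalised_def negate_in_cube)
    have "cond_var n (normalised f) S b = cond_var n f S b / D\<^sup>2"
      if "S \<in> Q" "b \<in> cube ({1..n} - S)" for S b
    proof -
      have S: "S \<subseteq> {1..n}" using that(1) Q(1) by auto
      then have "finite S" by (rule finite_subset) simp
      have "cond_var n (normalised f) S b = cube_var S (\<lambda>y. subfun n f S b y / D)"
        unfolding cond_var_def using S \<open>finite S\<close> that
        by (intro cube_var_cong) (simp_all only: subfun_def normalised_def D_def merge_in_cube if_True)
      with \<open>finite S\<close> show ?thesis by (simp add: cube_var_divide cond_var_def)
    qed
    then have "sqrt (cond_var n (normalised f) S b) \<le> 1"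
      if "S \<in> Q" "b \<in> cube ({1..n} - S)" for S b
      using that std_le_max_std[OF Q(1) that, of f] \<open>0 < D\<close>
      by (simp add: real_sqrt_divide D_def)
    then have std: "max_std n Q (normalised f) \<le> 1"
      by (simp add: max_std_le_iff[OF Q])
    have "sup_norm n (normalised f) \<le> c"
      using bound[OF odd] mult_left_mono[OF std \<open>0 \<le> c\<close>] by simp
    then have "normalised f x \<in> (if x \<in> cube {1..n} then {-c..c} else {0})" for x
      unfolding sup_norm_le_iff
      by (cases "x \<in> cube {1..n}") (force simp: abs_le_iff, simp add: normalised_def)
    with odd std show "normalised f \<in> K"
      unfolding K_def by (auto simp: PiE_iff)
    have "(\<lambda>x. \<bar>normalised f x\<bar>) ` cube {1..n} = (\<lambda>r. r / D) ` (\<lambda>x. \<bar>f x\<bar>) ` cube {1..n}"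
      using \<open>0 < D\<close> unfolding image_image
      by (intro image_cong) (auto simp: normalised_def D_def[symmetric])
    moreover have "Max ((\<lambda>r. r / D) ` (\<lambda>x. \<bar>f x\<bar>) ` cube {1..n})
        = Max ((\<lambda>x. \<bar>f x\<bar>) ` cube {1..n}) / D"
      using \<open>0 < D\<close> by (intro mono_Max_commute[symmetric] monoI) (auto simp: divide_right_mono)
    ultimately show "sup_norm n (normalised f) = sup_norm n f / max_std n Q f"
      by (simp add: sup_norm_def D_def)
  qed
  have "K \<noteq> {}" using norm_K[OF g] by auto
  with \<open>compact K\<close> obtain h where h: "h \<in> K" "\<And>f. f \<in> K \<Longrightarrow> sup_norm n f \<le> sup_norm n h"
    using continuous_attains_sup[OF _ _ continuous_on_sup_norm] by metis
  have h_odd: "odd_fun n h" and h_std: "max_std n Q h \<le> 1"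
    using h(1) by (auto simp: K_def)
  \<comment> \<open>The zero function also lies in \<open>K\<close>; comparison with
    \<open>normalised g\<close> shows that the maximiser is not it.\<close>
  have "0 < sup_norm n (normalised g)"
    using D_pos[OF g] g(2) by (simp add: sup_norm_normalised[OF g] sup_norm_pos_iff)
  with h(2)[OF norm_K[OF g]] have h_pos: "0 < sup_norm n h" by linarith
  then have h_nz: "\<exists>x\<in>cube {1..n}. h x \<noteq> 0" by (simp add: sup_norm_pos_iff)
  have best: "sup_norm n f / max_std n Q f \<le> sup_norm n h / max_std n Q h"
    if "odd_fun n f" "\<exists>x\<in>cube {1..n}. f x \<noteq> 0" for f
  proof -
    have "sup_norm n f / max_std n Q f \<le> sup_norm n h"
      using h(2)[OF norm_K[OF that]] sup_norm_normalised[OF that] by simp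
    \<comment> \<open>Here \<open>max_std n Q h <= 1\<close> suffices: dividing by it can only
      increase the ratio.\<close>
    also have "\<dots> \<le> sup_norm n h / max_std n Q h"
      using h_pos h_std D_pos[OF h_odd h_nz] by (simp add: field_simps)
    finally show ?thesis .
  qed
  have "val n Q = sup_norm n h / max_std n Q h"
    unfolding val_def using h_odd h_nz best by (intro Greatest_equality) blast+
  with best[OF g] bound[OF h_odd] D_pos[OF h_odd h_nz]
  show "sup_norm n g / max_std n Q g \<le> val n Q" "val n Q \<le> c"
    by (auto simp: divide_le_eq)
qed

section \<open>The lower bound\<close>

text \<open>The event that the walk is still running after \<open>x n\<close> down to
  \<open>x (Suc i)\<close> are revealed. It holds trivially for \<open>i = n\<close> and
  \<open>i = n - 1\<close>, so the first revealed sign never stops the walk.\<close>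

definition const_after :: "nat \<Rightarrow> nat \<Rightarrow> (nat \<Rightarrow> real) \<Rightarrow> bool" where
  "const_after n i x \<longleftrightarrow> (\<forall>l\<in>{i<..n}. x l = x n)"

text \<open>Value of the stopped walk once the coordinates above \<open>i\<close> are
  revealed.\<close>

definition partial_run_sum :: "nat \<Rightarrow> nat \<Rightarrow> (nat \<Rightarrow> real) \<Rightarrow> real" where
  "partial_run_sum n i x = (\<Sum>j\<in>{i<..n}. if const_after n j x then x j else 0)"

abbreviation run_sum :: "nat \<Rightarrow> (nat \<Rightarrow> real) \<Rightarrow> real" where
  "run_sum n \<equiv> partial_run_sum n 0"

lemma odd_run_sum: "odd_fun n (run_sum n)"
proof -
  have "const_after n j (restrict (\<lambda>i. - x i) {1..n}) \<longleftrightarrow> const_after n j x" for j x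
    by (auto simp: const_after_def)
  then show ?thesis
    unfolding odd_fun_def partial_run_sum_def
    by (auto simp flip: sum_negf intro!: sum.cong)
qed

lemma partial_run_sum_cong:
  "(\<And>l. i < l \<Longrightarrow> l \<le> n \<Longrightarrow> x l = y l) \<Longrightarrow> partial_run_sum n i x = partial_run_sum n i y"
  unfolding partial_run_sum_def const_after_def
  by (intro sum.cong refl if_cong ball_cong) simp_all

lemma partial_run_sum_upd:
  assumes "Suc i \<le> n"
  shows "partial_run_sum n i (b(Suc i := s))
       = partial_run_sum n (Suc i) b + (if const_after n (Suc i) b then s else 0)"
proof -
  have "{i<..n} = insert (Suc i) {Suc i<..n}" using assms by auto
  \<comment> \<open>For \<open>j < n\<close> the reference coordinate \<open>n\<close> is not the
    updated one; for \<open>j >= n\<close> the condition is vacuous.\<close>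
  moreover have "const_after n j (b(Suc i := s)) \<longleftrightarrow> const_after n j b" if "Suc i \<le> j" for j
    using that by (cases "j < n") (auto simp: const_after_def)
  ultimately show ?thesis
    by (auto simp: partial_run_sum_def intro!: sum.cong)
qed

text \<open>Martingale property: whether the next step is taken is already decided by the revealed
  coordinates, so its two signs cancel on average.\<close>

lemma cond_mean_run_sum:
  assumes "i \<le> n"
  shows "cond_mean n (run_sum n) {1..i} b = partial_run_sum n i b"
  using assms
proof (induction i arbitrary: b)
  case 0
  have "run_sum n (merge {} {1..n} (\<lambda>_. undefined, b)) = run_sum n b"
    by (rule partial_run_sum_cong) (auto simp: merge_def)
  then show ?case by (simp add: cond_mean_def subfun_def)
next
  case (Suc i)
  have "{1..Suc i} = insert (Suc i) {1..i}" by auto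
  with Suc show ?case
    by (simp add: cond_mean_insert partial_run_sum_upd)
qed

text \<open>While the walk runs, a step adds variance \<open>1\<close> and at most one of the two
  signs keeps it running. A bound \<open>v\<close> therefore reproduces itself when
  \<open>v / 2 + 1 <= v\<close>, whence \<open>2\<close>. After stopping the variance is
  \<open>0\<close>.\<close>

lemma cond_var_run_sum_le:
  assumes "i \<le> n"
  shows "cond_var n (run_sum n) {1..i} b
       \<le> (if i = n then 3 else if const_after n i b then 2 else 0)"
  using assms
proof (induction i arbitrary: b)
  case 0
  then show ?case by (simp add: cond_var_def)
next
  case (Suc i)
  let ?V = "\<lambda>s. cond_var n (run_sum n) {1..i} (b(Suc i := s))"
  have "{1..Suc i} = insert (Suc i) {1..i}" by auto
  then have rec: "cond_var n (run_sum n) {1..Suc i} b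
      = (?V 1 + ?V (-1)) / 2 + (if const_after n (Suc i) b then 1 else 0)"
    using Suc.prems
    by (simp add: cond_var_insert cond_mean_run_sum[simplified] partial_run_sum_upd)
  have "i \<noteq> n" using Suc.prems by simp
  then have V_le: "?V s \<le> (if const_after n i (b(Suc i := s)) then 2 else 0)" for s
    using Suc.IH[OF Suc_leD[OF Suc.prems], of "b(Suc i := s)"] \<open>i \<noteq> n\<close>
    by (simp only: if_False)
  show ?case
  proof (cases "Suc i = n")
    case True
    \<comment> \<open>The coordinate being revealed is \<open>n\<close> itself, so both signs keep
      the walk running and the bound is \<open>2 + 1\<close>.\<close>
    have "?V 1 \<le> 2" "?V (-1) \<le> 2"
      using V_le[of 1] V_le[of "-1"] by (auto split: if_splits)
    then have "cond_var n (run_sum n) {1..Suc i} b \<le> 3"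
      unfolding rec by simp
    then show ?thesis unfolding if_P[OF True] .
  next
    case False
    have "{i<..n} = insert (Suc i) {Suc i<..n}" using Suc.prems by auto
    with False have const_iff:
      "const_after n i (b(Suc i := s)) \<longleftrightarrow> const_after n (Suc i) b \<and> s = b n" for s
      by (auto simp: const_after_def)
    have "?V 1 + ?V (-1) \<le> (if const_after n (Suc i) b then 2 else 0)"
      using V_le[of 1] V_le[of "-1"] unfolding const_iff
      by (cases "b n = 1") (simp_all split: if_splits)
    then have "cond_var n (run_sum n) {1..Suc i} b \<le> (if const_after n (Suc i) b then 2 else 0)"
      unfolding rec by (simp split: if_splits)
    then show ?thesis unfolding if_not_P[OF False] .
  qed
qed

lemma run_sum_ones: "run_sum n (\<lambda>i\<in>{1..n}. 1) = real n"
proof -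
  have "run_sum n (\<lambda>i\<in>{1..n}. 1) = (\<Sum>j\<in>{0<..n}. 1)"
    unfolding partial_run_sum_def by (intro sum.cong) (auto simp: const_after_def)
  then show ?thesis by simp
qed

theorem theorem4p6:
  fixes n :: nat and Q :: "nat set set"
  assumes "n > 0"
    and "Q = {{1..i} |i. i \<in> {1..n}}"
  shows "real n / sqrt 8 \<le> val n Q \<and> val n Q \<le> real n"
proof -
  have Q: "Q \<subseteq> Pow {1..n}" "Q \<noteq> {}"
    using assms by auto
  have ones: "(\<lambda>i\<in>{1..n}. 1) \<in> cube {1..n}"
    by (auto simp: cube_def)
  have nz: "\<exists>x\<in>cube {1..n}. run_sum n x \<noteq> 0"
    using assms(1) ones run_sum_ones[of n] by (intro bexI[OF _ ones]) simp
  have sup: "real n \<le> sup_norm n (run_sum n)"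
    using abs_le_sup_norm[OF ones, of "run_sum n"] unfolding run_sum_ones by simp
  \<comment> \<open>The variances are at most \<open>3\<close>; the constant \<open>8\<close> of the
    claim leaves slack.\<close>
  have "cond_var n (run_sum n) {1..i} b \<le> 8" if "i \<le> n" for i b
    using cond_var_run_sum_le[OF that, of b] by (auto split: if_splits)
  then have std: "max_std n Q (run_sum n) \<le> sqrt 8"
    unfolding max_std_le_iff[OF Q] using assms(2) by auto
  \<comment> \<open>The upper bound applied to \<open>run_sum\<close> itself rules out a zero
    denominator.\<close>
  have "0 < real n * max_std n Q (run_sum n)"
    using sup_norm_le_max_std[OF odd_run_sum assms(2)] sup assms(1) by linarith
  then have "0 < max_std n Q (run_sum n)"
    by (simp add: zero_less_mult_iff)
  then have "real n / sqrt 8 \<le> sup_norm n (run_sum n) / max_std n Q (run_sum n)"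
    using sup std by (intro frac_le) auto
  with val_attained[OF Q sup_norm_le_max_std[OF _ assms(2)] _ odd_run_sum nz]
  show ?thesis by force
qed

end
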